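(* Let $\Gamma=\Gamma_1\oplus\Gamma_2$ with $\Gamma_1=\mathbb Z_{2^{n_1}}\oplus\cdots\oplus\mathbb Z_{2^{n_r}}$, $\Gamma_2=\mathbb Z_{p_1^{m_1}}\oplus\cdots\oplus\mathbb Z_{p_s^{m_s}}$, all $p_i>2$ prime, and $\mathbf m_\Gamma=(2^{n_1},\dots,2^{n_r},p_1^{m_1},\dots,p_s^{m_s})$. Let $\mathbf D$ be a set of divisor tuples of $\mathbf m_\Gamma$ such that $Cay(\Gamma,S_\Gamma(\mathbf D))$ admits perfect state transfer at $\frac{\pi}{2^k}$ for some positive integer $k$. Let $d_{r+1},\dots,d_{r+s}$ be fixed divisors of $p_1^{m_1},\dots,p_s^{m_s}$, respectively, and let $\mathbf D'$ be a set of divisor tuples $\mathbf d=(d_1,\dots,d_r,d_{r+1},\dots,d_{r+s})$ of $\mathbf m_\Gamma$ (all having these last $s$ components) with $\mathbf D\cap\mathbf D'=\emptyset$. Suppose $Cay(\Gamma,S_\Gamma(\mathbf D'))\cong X(\mathbf C')\times G$, where $X(\mathbf C')$ is a cubelike graph with $|\mathbf C'|$ odd and $G$ is an integral graph. Then $Cay(\Gamma,S_\Gamma(\mathbf D\cup\mathbf D'))$ is periodic at $\pi$ if and only if all eigenvalues of $G$ have the same parity.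
   Context: Transition matrix of a graph with adjacency matrix $A$ (loops contribute $1$ on the diagonal): $H(t)=\exp(itA)$. The graph admits perfect state transfer at $\tau$ if $|H(\tau)_{uv}|=1$ for some distinct vertices $u,v$; it is periodic at $\tau$ if $|H(\tau)_{uu}|=1$ for every vertex $u$. $Cay(\Gamma,S)$: vertex set $\Gamma$, $a\sim b$ iff $a-b\in S$. Gcd-sets: represent components $x_i$ by integers in $\{0,\dots,(\mathbf m_\Gamma)_i-1\}$, with $\gcd(0,n)=n$; for a divisor tuple $\mathbf d$ of $\mathbf m_\Gamma$ (each $d_i\ge1$ divides $(\mathbf m_\Gamma)_i$), $S_\Gamma(\mathbf d)=\{\mathbf x\in\Gamma:\gcd(x_i,(\mathbf m_\Gamma)_i)=d_i\ \forall i\}$, $S_\Gamma(\mathbf D)=\bigcup_{\mathbf d\in\mathbf D}S_\Gamma(\mathbf d)$. A cubelike graph $X(\mathbf C')$ is $Cay(\mathbb Z_2^N,\mathbf C')$ with $\mathbf C'\subseteq\mathbb Z_2^N$. A graph is integral if all its adjacency eigenvalues are integers. The Kronecker product $G_1\times G_2$ has adjacency matrix $A_1\otimes A_2$ ($(u_1,u_2)\sim(v_1,v_2)$ iff $u_1\sim v_1$ and $u_2\sim v_2$). *)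

theory Defs
  imports
    Complex_Main
    "HOL-Library.Countable_Set"
    "HOL-Algebra.Product_Groups"
    "HOL-Computational_Algebra.Primes"
    "Jordan_Normal_Form.Char_Poly"
    "Graph_Theory.Graph_Theory"
begin

text \<open>
  Graphs are finite symmetric digraphs without parallel arcs and possibly with loops, i.e. the
  locale \<^locale>\<open>pair_pseudo_graph\<close>. A loop is a single arc from a vertex to itself, so it
  contributes 1 to the diagonal of the adjacency matrix.

  Rows and columns of matrices are indexed by natural numbers; vertex \<open>v\<close> has index
  \<open>to_nat_on (pverts G) v\<close>, the library's fixed bijection from a finite set \<open>V\<close> onto
  \<open>{..<card V}\<close>. Eigenvalues, and the matrix entries belonging to given vertices, do not
  depend on the bijection chosen.
\<close>

definition adj_mat :: "'a pair_pre_digraph \<Rightarrow> complex mat" where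
  "adj_mat G = (let V = pverts G in
     mat (card V) (card V)
       (\<lambda>(i, j). if (from_nat_into V i, from_nat_into V j) \<in> parcs G then 1 else 0))"

definition mat_exp :: "complex mat \<Rightarrow> complex mat" where
  "mat_exp A = mat (dim_row A) (dim_row A)
     (\<lambda>(i, j). \<Sum>n. (A ^\<^sub>m n) $$ (i, j) / fact n)"

definition transition_mat :: "'a pair_pre_digraph \<Rightarrow> real \<Rightarrow> complex mat" where
  "transition_mat G t = mat_exp ((\<i> * complex_of_real t) \<cdot>\<^sub>m adj_mat G)"

definition transition_entry :: "'a pair_pre_digraph \<Rightarrow> real \<Rightarrow> 'a \<Rightarrow> 'a \<Rightarrow> complex" where
  "transition_entry G t u v =
     transition_mat G t $$ (to_nat_on (pverts G) u, to_nat_on (pverts G) v)"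

definition perfect_state_transfer_at :: "'a pair_pre_digraph \<Rightarrow> real \<Rightarrow> bool" where
  "perfect_state_transfer_at G \<tau> \<longleftrightarrow>
     (\<exists>u\<in>pverts G. \<exists>v\<in>pverts G. u \<noteq> v \<and> cmod (transition_entry G \<tau> u v) = 1)"

definition periodic_at :: "'a pair_pre_digraph \<Rightarrow> real \<Rightarrow> bool" where
  "periodic_at G \<tau> \<longleftrightarrow> (\<forall>u\<in>pverts G. cmod (transition_entry G \<tau> u u) = 1)"

definition integral_graph :: "'a pair_pre_digraph \<Rightarrow> bool" where
  "integral_graph G \<longleftrightarrow> pair_pseudo_graph G \<and> (\<forall>x. eigenvalue (adj_mat G) x \<longrightarrow> x \<in> \<int>)"

definition eigenvalues_same_parity :: "'a pair_pre_digraph \<Rightarrow> bool" where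
  "eigenvalues_same_parity G \<longleftrightarrow>
     (\<forall>x. eigenvalue (adj_mat G) x \<longrightarrow> (\<exists>z::int. x = of_int z \<and> even z)) \<or>
     (\<forall>x. eigenvalue (adj_mat G) x \<longrightarrow> (\<exists>z::int. x = of_int z \<and> odd z))"

definition kronecker_product ::
  "'a pair_pre_digraph \<Rightarrow> 'b pair_pre_digraph \<Rightarrow> ('a \<times> 'b) pair_pre_digraph" where
  "kronecker_product G1 G2 =
     \<lparr> pverts = pverts G1 \<times> pverts G2,
       parcs = {((u1, u2), (v1, v2)) | u1 u2 v1 v2. (u1, v1) \<in> parcs G1 \<and> (u2, v2) \<in> parcs G2} \<rparr>"

definition cayley_graph :: "('a, 'c) monoid_scheme \<Rightarrow> 'a set \<Rightarrow> 'a pair_pre_digraph" where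
  "cayley_graph \<Gamma> S =
     \<lparr> pverts = carrier \<Gamma>,
       parcs = {(a, b). a \<in> carrier \<Gamma> \<and> b \<in> carrier \<Gamma> \<and> a \<otimes>\<^bsub>\<Gamma>\<^esub> inv\<^bsub>\<Gamma>\<^esub> b \<in> S} \<rparr>"

text \<open>
  For a list \<open>m\<close> of positive moduli, the direct sum of the groups of integers modulo
  \<open>m ! i\<close>. Its elements are the extensional functions \<open>x\<close> on \<open>{..<length m}\<close>
  with \<open>0 \<le> x i < m ! i\<close>.
\<close>

definition cyclic_sum :: "nat list \<Rightarrow> (nat \<Rightarrow> int) monoid" where
  "cyclic_sum m = product_group {..<length m} (\<lambda>i. integer_mod_group (m ! i))"

definition divisor_tuple :: "nat list \<Rightarrow> nat list \<Rightarrow> bool" where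
  "divisor_tuple m d \<longleftrightarrow> length d = length m \<and> (\<forall>i<length m. 1 \<le> d ! i \<and> d ! i dvd m ! i)"

definition gcd_class :: "nat list \<Rightarrow> nat list \<Rightarrow> (nat \<Rightarrow> int) set" where
  "gcd_class m d =
     {x \<in> carrier (cyclic_sum m). \<forall>i<length m. gcd (x i) (int (m ! i)) = int (d ! i)}"

definition gcd_set :: "nat list \<Rightarrow> nat list set \<Rightarrow> (nat \<Rightarrow> int) set" where
  "gcd_set m D = (\<Union>d\<in>D. gcd_class m d)"

definition cubelike_graph :: "nat \<Rightarrow> (nat \<Rightarrow> int) set \<Rightarrow> (nat \<Rightarrow> int) pair_pre_digraph" where
  "cubelike_graph N C = cayley_graph (cyclic_sum (replicate N 2)) C"

end

theory Submission
  imports Defs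
begin

text \<open>
  The characters \<open>\<chi>\<^sub>y\<close> of \<open>\<Gamma>\<close> diagonalise every Cayley graph on \<open>\<Gamma>\<close> simultaneously, with
  eigenvalues \<open>\<lambda>\<^sub>y(S) = (\<Sum>s\<in>S. \<chi>\<^sub>y(s))\<close>, so that
  \<open>H(t)\<^sub>u\<^sub>v\<close> is the average over \<open>y\<close> of \<open>exp (\<i> t \<lambda>\<^sub>y) \<chi>\<^sub>y(u - v)\<close>. It has modulus 1 iff all these
  terms coincide. For inverse-closed \<open>S\<close>, perfect state transfer at \<open>t\<close> therefore forces
  periodicity at \<open>2 t\<close>, hence here at \<open>\<pi>\<close>. As \<open>\<lambda>\<^sub>y\<close> is additive over disjoint connection sets,
  the part \<open>D\<close> only contributes a constant phase at \<open>\<pi>\<close>, and periodicity of the union is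
  periodicity of the graph of \<open>D'\<close>. The eigenvalues of the latter are products of an
  eigenvalue of \<open>X(C')\<close>, which is a sum of \<open>|C'|\<close> signs and so an odd integer, and an eigenvalue
  of \<open>G\<close>.
\<close>

section \<open>Adjacency operators and eigenvalues\<close>

text \<open>The adjacency matrix acting on functions on vertices; this form needs no numbering of
  the vertices.\<close>

definition adj_op :: "'a pair_pre_digraph \<Rightarrow> ('a \<Rightarrow> complex) \<Rightarrow> 'a \<Rightarrow> complex" where
  "adj_op G f u = (\<Sum>v\<in>{v \<in> pverts G. (u, v) \<in> parcs G}. f v)"

definition graph_eigenvalue :: "'a pair_pre_digraph \<Rightarrow> complex \<Rightarrow> bool" where
  "graph_eigenvalue G x \<longleftrightarrow>
     (\<exists>f. (\<exists>v\<in>pverts G. f v \<noteq> 0) \<and> (\<forall>u\<in>pverts G. adj_op G f u = x * f u))"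

section \<open>Numbering of vertices and the adjacency matrix\<close>

lemma to_nat_on_less: "finite V \<Longrightarrow> v \<in> V \<Longrightarrow> to_nat_on V v < card V"
  using to_nat_on_finite[of V] by (auto simp: bij_betw_def)

lemma sum_to_nat_on:
  assumes "finite V"
  shows "(\<Sum>i<card V. f i) = (\<Sum>v\<in>V. f (to_nat_on V v))"
  using sum.reindex_bij_betw[OF to_nat_on_finite[OF assms], of f] by simp

lemma from_nat_into_finite: "finite V \<Longrightarrow> i < card V \<Longrightarrow> from_nat_into V i \<in> V"
  by (intro from_nat_into) auto

lemma to_nat_on_from_nat_into_finite:
  "finite V \<Longrightarrow> i < card V \<Longrightarrow> to_nat_on V (from_nat_into V i) = i"
  using to_nat_on_finite[of V] by (intro to_nat_on_from_nat_into) (auto simp: bij_betw_def)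

lemma adj_mat_carrier: "adj_mat G \<in> carrier_mat (card (pverts G)) (card (pverts G))"
  by (simp add: adj_mat_def Let_def)

lemma adj_mat_entry:
  assumes "finite (pverts G)" "u \<in> pverts G" "v \<in> pverts G"
  shows "adj_mat G $$ (to_nat_on (pverts G) u, to_nat_on (pverts G) v) =
    (if (u, v) \<in> parcs G then 1 else 0)"
  using assms by (simp add: adj_mat_def Let_def to_nat_on_less countable_finite)

lemma mult_adj_mat_entry:
  assumes "finite (pverts G)" "v \<in> pverts G"
    and "B \<in> carrier_mat (card (pverts G)) (card (pverts G))" "i < card (pverts G)"
  shows "(B * adj_mat G) $$ (i, to_nat_on (pverts G) v) =
    (\<Sum>w\<in>{w \<in> pverts G. (w, v) \<in> parcs G}. B $$ (i, to_nat_on (pverts G) w))"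
proof -
  let ?V = "pverts G"
  note A = adj_mat_carrier[of G]
  have "(B * adj_mat G) $$ (i, to_nat_on ?V v) =
      (\<Sum>j<card ?V. B $$ (i, j) * adj_mat G $$ (j, to_nat_on ?V v))"
    using A assms to_nat_on_less[OF assms(1,2)]
    by (simp add: times_mat_def scalar_prod_def atLeast0LessThan)
  also have "\<dots> = (\<Sum>w\<in>?V. B $$ (i, to_nat_on ?V w) * adj_mat G $$ (to_nat_on ?V w, to_nat_on ?V v))"
    by (rule sum_to_nat_on[OF assms(1)])
  also have "\<dots> = (\<Sum>w\<in>?V. if (w, v) \<in> parcs G then B $$ (i, to_nat_on ?V w) else 0)"
    using assms by (intro sum.cong) (auto simp: adj_mat_entry)
  finally show ?thesis
    using assms(1) by (simp add: sum.inter_filter)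
qed

lemma adj_mat_mult_vec:
  assumes "finite (pverts G)" "u \<in> pverts G" "w \<in> carrier_vec (card (pverts G))"
  shows "(adj_mat G *\<^sub>v w) $ to_nat_on (pverts G) u = adj_op G (\<lambda>v. w $ to_nat_on (pverts G) v) u"
proof -
  let ?V = "pverts G"
  note A = adj_mat_carrier[of G]
  have "(adj_mat G *\<^sub>v w) $ to_nat_on ?V u =
      (\<Sum>j<card ?V. adj_mat G $$ (to_nat_on ?V u, j) * w $ j)"
    using A assms to_nat_on_less[OF assms(1,2)]
    by (simp add: mult_mat_vec_def scalar_prod_def atLeast0LessThan)
  also have "\<dots> = (\<Sum>v\<in>?V. adj_mat G $$ (to_nat_on ?V u, to_nat_on ?V v) * w $ to_nat_on ?V v)"
    by (rule sum_to_nat_on[OF assms(1)])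
  also have "\<dots> = (\<Sum>v\<in>?V. if (u, v) \<in> parcs G then w $ to_nat_on ?V v else 0)"
    using assms by (intro sum.cong) (auto simp: adj_mat_entry)
  finally show ?thesis
    using assms(1) by (simp add: adj_op_def sum.inter_filter)
qed

lemma adj_op_cong:
  "(\<And>v. v \<in> pverts G \<Longrightarrow> f v = g v) \<Longrightarrow> adj_op G f u = adj_op G g u"
  unfolding adj_op_def by (rule sum.cong) auto

text \<open>Vectors and functions on the vertices correspond through the numbering
  \<open>to_nat_on\<close>. From here on spectra can be studied without matrix indices.\<close>

lemma eigenvalue_adj_mat_iff:
  assumes fin: "finite (pverts G)"
  shows "eigenvalue (adj_mat G) x \<longleftrightarrow> graph_eigenvalue G x"
proof
  let ?V = "pverts G"
  have dim: "dim_row (adj_mat G) = card ?V"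
    using adj_mat_carrier[of G] by simp
  assume "eigenvalue (adj_mat G) x"
  then obtain w where w: "w \<in> carrier_vec (card ?V)" "w \<noteq> 0\<^sub>v (card ?V)"
      "adj_mat G *\<^sub>v w = x \<cdot>\<^sub>v w"
    unfolding eigenvalue_def eigenvector_def dim by auto
  have "\<exists>i<card ?V. w $ i \<noteq> 0"
  proof (rule ccontr)
    assume "\<not> ?thesis"
    then have "w = 0\<^sub>v (card ?V)"
      using w(1) by (intro eq_vecI) auto
    with w(2) show False ..
  qed
  then obtain i where i: "i < card ?V" "w $ i \<noteq> 0"
    by auto
  show "graph_eigenvalue G x"
    unfolding graph_eigenvalue_def
  proof (intro exI conjI ballI)
    show "\<exists>v\<in>?V. w $ to_nat_on ?V v \<noteq> 0"
      using i fin by (intro bexI[of _ "from_nat_into ?V i"])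
        (auto simp: to_nat_on_from_nat_into_finite from_nat_into_finite)
    fix u assume u: "u \<in> ?V"
    show "adj_op G (\<lambda>v. w $ to_nat_on ?V v) u = x * w $ to_nat_on ?V u"
      using adj_mat_mult_vec[OF fin u w(1)] w to_nat_on_less[OF fin u] by simp
  qed
next
  let ?V = "pverts G"
  have dim: "dim_row (adj_mat G) = card ?V"
    using adj_mat_carrier[of G] by simp
  assume "graph_eigenvalue G x"
  then obtain f where f: "\<exists>v\<in>?V. f v \<noteq> 0" "\<And>u. u \<in> ?V \<Longrightarrow> adj_op G f u = x * f u"
    unfolding graph_eigenvalue_def by auto
  define w where "w = vec (card ?V) (\<lambda>i. f (from_nat_into ?V i))"
  have w: "w \<in> carrier_vec (card ?V)"
    by (simp add: w_def)
  have w_nth: "w $ to_nat_on ?V v = f v" if "v \<in> ?V" for v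
    using that fin by (simp add: w_def to_nat_on_less countable_finite)
  have "adj_mat G *\<^sub>v w = x \<cdot>\<^sub>v w"
  proof (rule eq_vecI)
    fix i assume "i < dim_vec (x \<cdot>\<^sub>v w)"
    then have i: "i < card ?V"
      using w by simp
    define u where "u = from_nat_into ?V i"
    have u: "u \<in> ?V" "to_nat_on ?V u = i"
      using i fin by (simp_all add: u_def from_nat_into_finite to_nat_on_from_nat_into_finite)
    have "(adj_mat G *\<^sub>v w) $ i = adj_op G f u"
      unfolding adj_mat_mult_vec[OF fin u(1) w, unfolded u(2)] by (rule adj_op_cong) (rule w_nth)
    then show "(adj_mat G *\<^sub>v w) $ i = (x \<cdot>\<^sub>v w) $ i"
      using f(2)[OF u(1)] w_nth[OF u(1)] u(2) i w by simp
  qed (use w adj_mat_carrier[of G] in simp)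
  moreover have "w \<noteq> 0\<^sub>v (card ?V)"
  proof
    assume "w = 0\<^sub>v (card ?V)"
    then have "f v = 0" if "v \<in> ?V" for v
      using w_nth[OF that] to_nat_on_less[OF fin that] by simp
    with f(1) show False
      by blast
  qed
  ultimately show "eigenvalue (adj_mat G) x"
    unfolding eigenvalue_def eigenvector_def dim using w by blast
qed

section \<open>Powers of the adjacency matrix and the transition matrix\<close>

lemma smult_mat_pow:
  assumes "A \<in> carrier_mat n n"
  shows "((c :: 'a :: comm_ring_1) \<cdot>\<^sub>m A) ^\<^sub>m k = c ^ k \<cdot>\<^sub>m (A ^\<^sub>m k)"
proof (induction k)
  case 0
  show ?case
    using assms by (intro eq_matI) auto
next
  case (Suc k)
  have Ak: "A ^\<^sub>m k \<in> carrier_mat n n"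
    using assms by simp
  have "(c \<cdot>\<^sub>m A) ^\<^sub>m Suc k = (c ^ k \<cdot>\<^sub>m (A ^\<^sub>m k)) * (c \<cdot>\<^sub>m A)"
    by (simp add: Suc)
  also have "\<dots> = c ^ Suc k \<cdot>\<^sub>m (A ^\<^sub>m k * A)"
    using assms Ak by (intro eq_matI) (auto simp: mult.assoc)
  finally show ?case
    by simp
qed

text \<open>Pulling the scalar out of each power reduces the transition matrix to the powers of the
  adjacency matrix itself.\<close>

lemma transition_entry_eq:
  assumes fin: "finite (pverts G)" and uv: "u \<in> pverts G" "v \<in> pverts G"
  shows "transition_entry G t u v =
    (\<Sum>n. (\<i> * of_real t) ^ n *
       (adj_mat G ^\<^sub>m n) $$ (to_nat_on (pverts G) u, to_nat_on (pverts G) v) / fact n)"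
proof -
  note A = adj_mat_carrier[of G]
  have "adj_mat G ^\<^sub>m n \<in> carrier_mat (card (pverts G)) (card (pverts G))" for n
    using A by simp
  then show ?thesis
    unfolding transition_entry_def transition_mat_def mat_exp_def smult_mat_pow[OF A]
    using A uv by (auto simp: to_nat_on_less[OF fin] simp del: pow_mat_dim)
qed

section \<open>Invariance of the spectrum under isomorphism\<close>

text \<open>An eigenfunction \<open>g\<close> on \<open>H\<close> pulls back to
  \<open>g \<circ> f\<close> on \<open>G\<close>, because \<open>f\<close> maps neighbourhoods
  bijectively onto neighbourhoods.\<close>

lemma graph_eigenvalue_iso:
  assumes bij: "bij_betw f (pverts G) (pverts H)"
    and arcs: "\<And>u v. u \<in> pverts G \<Longrightarrow> v \<in> pverts G \<Longrightarrow> (f u, f v) \<in> parcs H \<longleftrightarrow> (u, v) \<in> parcs G"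
    and ev: "graph_eigenvalue H x"
  shows "graph_eigenvalue G x"
proof -
  from ev obtain g where g: "\<exists>v\<in>pverts H. g v \<noteq> 0" "\<And>u. u \<in> pverts H \<Longrightarrow> adj_op H g u = x * g u"
    unfolding graph_eigenvalue_def by auto
  have fV: "f v \<in> pverts H" if "v \<in> pverts G" for v
    using bij that by (auto simp: bij_betw_def)
  have "adj_op G (g \<circ> f) u = x * (g \<circ> f) u" if u: "u \<in> pverts G" for u
  proof -
    have "bij_betw f {v \<in> pverts G. (u, v) \<in> parcs G} {v \<in> pverts H. (f u, v) \<in> parcs H}"
      unfolding bij_betw_def
    proof
      show "inj_on f {v \<in> pverts G. (u, v) \<in> parcs G}"
        using bij by (auto simp: bij_betw_def inj_on_def)
      show "f ` {v \<in> pverts G. (u, v) \<in> parcs G} = {v \<in> pverts H. (f u, v) \<in> parcs H}"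
        unfolding bij_betw_imp_surj_on[OF bij, symmetric] using arcs[OF u] by auto
    qed
    then have "adj_op G (g \<circ> f) u = adj_op H g (f u)"
      unfolding adj_op_def by (simp add: sum.reindex_bij_betw)
    then show ?thesis
      using g(2)[OF fV[OF u]] by simp
  qed
  moreover have "\<exists>v\<in>pverts G. (g \<circ> f) v \<noteq> 0"
    using g(1) unfolding bij_betw_imp_surj_on[OF bij, symmetric] by simp
  ultimately show ?thesis
    unfolding graph_eigenvalue_def by blast
qed

text \<open>A library isomorphism has separate maps for vertices, arcs, tails and heads. As both
  graphs have pairs as arcs, its tail and head maps are \<open>fst\<close> and \<open>snd\<close>,
  so the arc map is determined by the vertex map.\<close>

lemma digraph_iso_with_projD:
  assumes "digraph_iso (with_proj G) (with_proj H)"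
  obtains f where "bij_betw f (pverts G) (pverts H)"
    and "\<And>u v. u \<in> pverts G \<Longrightarrow> v \<in> pverts G \<Longrightarrow> (f u, f v) \<in> parcs H \<longleftrightarrow> (u, v) \<in> parcs G"
proof -
  obtain h where h: "pre_digraph.digraph_isomorphism (with_proj G) h"
      and H: "with_proj H = app_iso h (with_proj G)"
    using assms unfolding digraph_iso_def by auto
  let ?f = "iso_verts h"
  have vH: "pverts H = ?f ` pverts G" and aH: "parcs H = iso_arcs h ` parcs G"
    and tl: "iso_tail h = fst" and hd: "iso_head h = snd"
    using H by (simp_all add: with_proj_def app_iso_def)
  have inj: "inj_on ?f (pverts G)" and wf: "wf_digraph (with_proj G)"
    and th: "\<And>a. a \<in> parcs G \<Longrightarrow> iso_arcs h a = (?f (fst a), ?f (snd a))"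
    using h unfolding pre_digraph.digraph_isomorphism_def by (auto simp: tl hd prod_eq_iff)
  have wfG: "\<And>a. a \<in> parcs G \<Longrightarrow> fst a \<in> pverts G \<and> snd a \<in> pverts G"
    using wf by (auto simp: wf_digraph_def)
  show thesis
  proof
    show "bij_betw ?f (pverts G) (pverts H)"
      using inj vH by (simp add: bij_betw_def)
    show "(?f u, ?f v) \<in> parcs H \<longleftrightarrow> (u, v) \<in> parcs G" if "u \<in> pverts G" "v \<in> pverts G" for u v
    proof
      assume "(u, v) \<in> parcs G"
      then show "(?f u, ?f v) \<in> parcs H"
        unfolding aH using th by force
    next
      assume "(?f u, ?f v) \<in> parcs H"
      then obtain a where a: "a \<in> parcs G" "(?f u, ?f v) = iso_arcs h a"
        unfolding aH by auto
      then have "u = fst a" "v = snd a"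
        using th[OF a(1)] wfG[OF a(1)] inj that by (auto dest: inj_onD)
      then show "(u, v) \<in> parcs G"
        using a(1) by simp
    qed
  qed
qed

lemma graph_eigenvalue_digraph_iso:
  assumes "digraph_iso (with_proj G) (with_proj H)"
  shows "graph_eigenvalue G x \<longleftrightarrow> graph_eigenvalue H x"
proof -
  obtain f where f: "bij_betw f (pverts G) (pverts H)"
    and arcs: "\<And>u v. u \<in> pverts G \<Longrightarrow> v \<in> pverts G \<Longrightarrow> (f u, f v) \<in> parcs H \<longleftrightarrow> (u, v) \<in> parcs G"
    using digraph_iso_with_projD[OF assms] by blast
  let ?g = "inv_into (pverts G) f"
  have g: "bij_betw ?g (pverts H) (pverts G)"
    by (rule bij_betw_inv_into[OF f])
  have "(?g u, ?g v) \<in> parcs G \<longleftrightarrow> (u, v) \<in> parcs H" if "u \<in> pverts H" "v \<in> pverts H" for u v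
    using arcs[of "?g u" "?g v"] that g f
    by (simp add: bij_betw_inv_into_right bij_betwE)
  then show ?thesis
    using graph_eigenvalue_iso[OF f arcs] graph_eigenvalue_iso[OF g] by blast
qed

section \<open>Cayley graphs on finite groups with a symmetric bicharacter\<close>

text \<open>The equality case of the triangle inequality. With \<open>c\<close> the direction of the
  sum, the numbers \<open>Re (f a * cnj c)\<close> are at most 1 and add up to
  \<open>card A\<close>, so each is 1 and every \<open>f a\<close> equals \<open>c\<close>.\<close>

lemma norm_sum_eq_card_imp_const:
  assumes "finite A" "\<And>a. a \<in> A \<Longrightarrow> cmod (f a) = 1" "cmod (\<Sum>a\<in>A. f a) = real (card A)"
    and "a \<in> A" "b \<in> A"
  shows "f a = f b"
proof -
  define s where "s = (\<Sum>a\<in>A. f a)"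
  have card: "card A > 0"
    using assms(1,4) by (auto simp: card_gt_0_iff)
  have s: "s \<noteq> 0"
    using assms(3) card by (auto simp: s_def)
  define c where "c = s / cmod s"
  have c: "cmod c = 1"
    using s by (simp add: c_def norm_divide)
  have le: "Re (f a * cnj c) \<le> 1" if "a \<in> A" for a
    using complex_Re_le_cmod[of "f a * cnj c"] assms(2)[OF that] c by (simp add: norm_mult)
  have "s * cnj c = of_real (cmod s)"
    using s by (simp add: c_def complex_norm_square[symmetric] power2_eq_square)
  then have "(\<Sum>a\<in>A. Re (f a * cnj c)) = real (card A)"
    using assms(3) by (metis Re_complex_of_real Re_sum s_def sum_distrib_right)
  then have "(\<Sum>a\<in>A. 1 - Re (f a * cnj c)) = 0"
    by (simp add: sum_subtractf)
  then have one: "Re (f a * cnj c) = 1" if "a \<in> A" for a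
    using sum_nonneg_eq_0_iff[OF assms(1), of "\<lambda>a. 1 - Re (f a * cnj c)"] le that by force
  have "f a = c" if "a \<in> A" for a
  proof -
    have "cmod (f a * cnj c) = 1"
      using assms(2)[OF that] c by (simp add: norm_mult)
    then have "Im (f a * cnj c) = 0"
      using one[OF that] by (simp add: cmod_def)
    with one[OF that] have "f a * cnj c = 1"
      by (simp add: complex_eq_iff)
    moreover have "cnj c * c = 1"
      using c by (simp add: complex_norm_square[symmetric] mult.commute)
    ultimately show ?thesis
      by (metis mult.assoc mult.left_neutral mult.right_neutral)
  qed
  then show ?thesis
    using assms(4,5) by simp
qed

text \<open>A finite abelian group identified with its dual: characters are indexed by group
  elements. Symmetry of the pairing lets inversion of the index act as complex conjugation;
  \<open>sum_chars\<close> is the source of orthogonality.\<close>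

locale self_dual_group = comm_group \<Gamma> for \<Gamma> :: "('a, 'c) monoid_scheme" (structure) +
  fixes \<chi> :: "'a \<Rightarrow> 'a \<Rightarrow> complex"
  assumes finite_carrier: "finite (carrier \<Gamma>)"
    and char_mult: "\<lbrakk>y \<in> carrier \<Gamma>; a \<in> carrier \<Gamma>; b \<in> carrier \<Gamma>\<rbrakk> \<Longrightarrow> \<chi> y (a \<otimes> b) = \<chi> y a * \<chi> y b"
    and norm_char: "\<lbrakk>y \<in> carrier \<Gamma>; a \<in> carrier \<Gamma>\<rbrakk> \<Longrightarrow> cmod (\<chi> y a) = 1"
    and char_sym: "\<lbrakk>y \<in> carrier \<Gamma>; a \<in> carrier \<Gamma>\<rbrakk> \<Longrightarrow> \<chi> y a = \<chi> a y"
    and sum_chars: "\<lbrakk>a \<in> carrier \<Gamma>; a \<noteq> \<one>\<rbrakk> \<Longrightarrow> (\<Sum>y\<in>carrier \<Gamma>. \<chi> y a) = 0"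
begin

text \<open>The condition on a connection set that makes its Cayley graph undirected and the
  character sums real.\<close>

definition inv_closed :: "'a set \<Rightarrow> bool" where
  "inv_closed S \<longleftrightarrow> S \<subseteq> carrier \<Gamma> \<and> (\<forall>s\<in>S. inv s \<in> S)"

definition char_sum :: "'a set \<Rightarrow> 'a \<Rightarrow> complex" where
  "char_sum S y = (\<Sum>s\<in>S. \<chi> y s)"

section \<open>Characters and Fourier analysis\<close>

lemma char_nonzero: "\<lbrakk>y \<in> carrier \<Gamma>; a \<in> carrier \<Gamma>\<rbrakk> \<Longrightarrow> \<chi> y a \<noteq> 0"
  using norm_char by fastforce

lemma char_one: "y \<in> carrier \<Gamma> \<Longrightarrow> \<chi> y \<one> = 1"
  using char_mult[of y \<one> \<one>] char_nonzero[of y \<one>] by simp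

lemma trivial_char: "a \<in> carrier \<Gamma> \<Longrightarrow> \<chi> \<one> a = 1"
  using char_sym[of \<one> a] char_one[of a] by simp

lemma char_mult_cnj: "\<lbrakk>y \<in> carrier \<Gamma>; a \<in> carrier \<Gamma>\<rbrakk> \<Longrightarrow> \<chi> y a * cnj (\<chi> y a) = 1"
  using norm_char by (simp add: complex_norm_square[symmetric])

lemma char_inv:
  assumes "y \<in> carrier \<Gamma>" "a \<in> carrier \<Gamma>"
  shows "\<chi> y (inv a) = cnj (\<chi> y a)"
proof -
  have "\<chi> y a * \<chi> y (inv a) = \<chi> y a * cnj (\<chi> y a)"
    using assms char_mult[of y a "inv a"] char_one[of y] char_mult_cnj[of y a] by simp
  then show ?thesis
    using char_nonzero[OF assms] by simp
qed

lemma char_inv_index: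
  "\<lbrakk>y \<in> carrier \<Gamma>; a \<in> carrier \<Gamma>\<rbrakk> \<Longrightarrow> \<chi> (inv y) a = cnj (\<chi> y a)"
  using char_sym char_inv by simp

lemma card_carrier_pos: "card (carrier \<Gamma>) > 0"
  using finite_carrier one_closed by (auto simp: card_gt_0_iff)

text \<open>For \<open>u \<noteq> v\<close> the summand is
  \<open>\<chi> y (u \<otimes> inv v)\<close> at a nontrivial element, so \<open>sum_chars\<close>
  applies.\<close>

lemma char_orthogonality:
  assumes "u \<in> carrier \<Gamma>" "v \<in> carrier \<Gamma>"
  shows "(\<Sum>y\<in>carrier \<Gamma>. \<chi> y u * cnj (\<chi> y v)) = (if u = v then of_nat (card (carrier \<Gamma>)) else 0)"
proof (cases "u = v")
  case True
  then show ?thesis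
    using assms by (simp add: char_mult_cnj)
next
  case False
  have "u \<otimes> inv v \<noteq> \<one>"
    using False assms by (metis inv_equality inv_inv inv_closed)
  moreover have "(\<Sum>y\<in>carrier \<Gamma>. \<chi> y u * cnj (\<chi> y v)) = (\<Sum>y\<in>carrier \<Gamma>. \<chi> y (u \<otimes> inv v))"
    using assms by (intro sum.cong) (auto simp: char_mult char_inv)
  ultimately show ?thesis
    using False assms sum_chars[of "u \<otimes> inv v"] by simp
qed

text \<open>Inversion permutes \<open>S\<close> and conjugates each summand.\<close>

lemma char_sum_real:
  assumes "inv_closed S" "y \<in> carrier \<Gamma>"
  shows "cnj (char_sum S y) = char_sum S y"
proof -
  have "bij_betw (\<lambda>s. inv s) S S"
    using assms(1) unfolding inv_closed_def
    by (intro bij_betwI[where g = "\<lambda>s. inv s"]) auto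
  then have "char_sum S y = (\<Sum>s\<in>S. \<chi> y (inv s))"
    unfolding char_sum_def by (rule sum.reindex_bij_betw[symmetric])
  also have "\<dots> = cnj (char_sum S y)"
    using assms unfolding char_sum_def inv_closed_def cnj_sum
    by (intro sum.cong) (auto simp: char_inv)
  finally show ?thesis
    by simp
qed

lemma inv_closed_commute:
  assumes "inv_closed S" "u \<in> carrier \<Gamma>" "v \<in> carrier \<Gamma>"
  shows "u \<otimes> inv v \<in> S \<longleftrightarrow> v \<otimes> inv u \<in> S"
proof -
  have "inv (u \<otimes> inv v) = v \<otimes> inv u" "inv (v \<otimes> inv u) = u \<otimes> inv v"
    using assms by (simp_all add: inv_mult m_comm)
  then show ?thesis
    using assms(1) unfolding inv_closed_def by metis
qed

text \<open>The neighbours of \<open>u\<close> are the elements \<open>s \<otimes> u\<close> with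
  \<open>s\<close> in \<open>S\<close>. Multiplicativity then makes \<open>\<chi> y\<close> an
  eigenfunction with eigenvalue \<open>char_sum S y\<close>.\<close>

lemma sum_neighbours_char:
  assumes S: "inv_closed S" and u: "u \<in> carrier \<Gamma>" and y: "y \<in> carrier \<Gamma>"
  shows "(\<Sum>v\<in>{v \<in> carrier \<Gamma>. u \<otimes> inv v \<in> S}. \<chi> y v) = char_sum S y * \<chi> y u"
proof -
  have SC: "\<And>s. s \<in> S \<Longrightarrow> s \<in> carrier \<Gamma>"
    using S by (auto simp: inv_closed_def)
  have "bij_betw (\<lambda>s. s \<otimes> u) S {v \<in> carrier \<Gamma>. v \<otimes> inv u \<in> S}"
    using u SC by (intro bij_betwI[where g = "\<lambda>v. v \<otimes> inv u"]) (auto simp: m_assoc)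
  moreover have "{v \<in> carrier \<Gamma>. u \<otimes> inv v \<in> S} = {v \<in> carrier \<Gamma>. v \<otimes> inv u \<in> S}"
    using inv_closed_commute[OF S u] by blast
  ultimately have "(\<Sum>v\<in>{v \<in> carrier \<Gamma>. u \<otimes> inv v \<in> S}. \<chi> y v) = (\<Sum>s\<in>S. \<chi> y (s \<otimes> u))"
    by (simp add: sum.reindex_bij_betw[symmetric])
  also have "\<dots> = char_sum S y * \<chi> y u"
    unfolding char_sum_def sum_distrib_right
    using SC u y by (intro sum.cong) (auto simp: char_mult)
  finally show ?thesis .
qed

text \<open>Adjacency is symmetric, so exchanging the sums moves the adjacency operator from
  \<open>g\<close> to its eigenfunction \<open>\<chi> y\<close>.\<close>

lemma fourier_convolution:
  assumes S: "inv_closed S" and y: "y \<in> carrier \<Gamma>"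
  shows "(\<Sum>u\<in>carrier \<Gamma>. \<chi> y u * (\<Sum>v\<in>{v \<in> carrier \<Gamma>. u \<otimes> inv v \<in> S}. g v)) =
    char_sum S y * (\<Sum>v\<in>carrier \<Gamma>. \<chi> y v * g v)"
proof -
  let ?C = "carrier \<Gamma>"
  have "(\<Sum>u\<in>?C. \<chi> y u * (\<Sum>v\<in>{v \<in> ?C. u \<otimes> inv v \<in> S}. g v)) =
      (\<Sum>u\<in>?C. \<Sum>v\<in>?C. if u \<otimes> inv v \<in> S then \<chi> y u * g v else 0)"
    using finite_carrier by (simp add: sum.inter_filter sum_distrib_left if_distrib cong: if_cong)
  also have "\<dots> = (\<Sum>v\<in>?C. \<Sum>u\<in>?C. if v \<otimes> inv u \<in> S then \<chi> y u * g v else 0)"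
    by (subst sum.swap, intro sum.cong refl) (simp add: inv_closed_commute[OF S])
  also have "\<dots> = (\<Sum>v\<in>?C. (\<Sum>u\<in>{u \<in> ?C. v \<otimes> inv u \<in> S}. \<chi> y u) * g v)"
    unfolding sum.inter_filter[OF finite_carrier] sum_distrib_right by (intro sum.cong) auto
  also have "\<dots> = char_sum S y * (\<Sum>v\<in>?C. \<chi> y v * g v)"
    using sum_neighbours_char[OF S _ y] by (simp add: sum_distrib_left mult.assoc)
  finally show ?thesis .
qed

text \<open>Fourier inversion: if all coefficients vanished, orthogonality would recover
  \<open>card (carrier \<Gamma>) * g a = 0\<close>.\<close>

lemma fourier_nonzero:
  assumes a: "a \<in> carrier \<Gamma>" "g a \<noteq> (0 :: complex)"
  obtains y where "y \<in> carrier \<Gamma>" "(\<Sum>v\<in>carrier \<Gamma>. \<chi> y v * g v) \<noteq> 0"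
proof (rule ccontr)
  let ?C = "carrier \<Gamma>"
  assume "\<not> thesis"
  with that have zero: "\<And>y. y \<in> ?C \<Longrightarrow> (\<Sum>v\<in>?C. \<chi> y v * g v) = 0"
    by blast
  have "0 = (\<Sum>y\<in>?C. cnj (\<chi> y a) * (\<Sum>v\<in>?C. \<chi> y v * g v))"
    by (simp add: zero)
  also have "\<dots> = (\<Sum>v\<in>?C. (\<Sum>y\<in>?C. \<chi> y v * cnj (\<chi> y a)) * g v)"
    unfolding sum_distrib_left sum_distrib_right
    by (subst sum.swap) (simp add: mult_ac)
  also have "\<dots> = (\<Sum>v\<in>?C. if v = a then of_nat (card ?C) * g v else 0)"
    using a by (intro sum.cong) (auto simp: char_orthogonality)
  also have "\<dots> = of_nat (card ?C) * g a"
    using a finite_carrier by (simp add: sum.delta)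
  finally show False
    using a card_carrier_pos by simp
qed

section \<open>Spectrum of a Cayley graph\<close>

lemma cayley_graph_verts: "pverts (cayley_graph \<Gamma> S) = carrier \<Gamma>"
  by (simp add: cayley_graph_def)

lemma cayley_graph_arcs:
  "(u, v) \<in> parcs (cayley_graph \<Gamma> S) \<longleftrightarrow> u \<in> carrier \<Gamma> \<and> v \<in> carrier \<Gamma> \<and> u \<otimes> inv v \<in> S"
  by (simp add: cayley_graph_def)

lemma adj_op_cayley_graph:
  assumes "u \<in> carrier \<Gamma>"
  shows "adj_op (cayley_graph \<Gamma> S) f u = (\<Sum>v\<in>{v \<in> carrier \<Gamma>. u \<otimes> inv v \<in> S}. f v)"
  unfolding adj_op_def cayley_graph_verts cayley_graph_arcs
  using assms by (intro sum.cong) auto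

text \<open>Given an eigenfunction, some Fourier coefficient is nonzero; there the convolution
  identity multiplies it both by \<open>x\<close> and by \<open>char_sum S y\<close>. Conversely
  \<open>\<chi> y\<close> is an eigenfunction, nonzero at \<open>\<one>\<close>.\<close>

lemma graph_eigenvalue_cayley_graph_iff:
  assumes S: "inv_closed S"
  shows "graph_eigenvalue (cayley_graph \<Gamma> S) x \<longleftrightarrow> (\<exists>y\<in>carrier \<Gamma>. x = char_sum S y)"
proof
  assume "graph_eigenvalue (cayley_graph \<Gamma> S) x"
  then obtain f a where a: "a \<in> carrier \<Gamma>" "f a \<noteq> 0"
      and adj: "\<And>u. u \<in> carrier \<Gamma> \<Longrightarrow> adj_op (cayley_graph \<Gamma> S) f u = x * f u"
    unfolding graph_eigenvalue_def cayley_graph_verts by auto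
  have f: "(\<Sum>v\<in>{v \<in> carrier \<Gamma>. u \<otimes> inv v \<in> S}. f v) = x * f u" if "u \<in> carrier \<Gamma>" for u
    using adj[OF that] adj_op_cayley_graph[OF that] by simp
  obtain y where y: "y \<in> carrier \<Gamma>" "(\<Sum>v\<in>carrier \<Gamma>. \<chi> y v * f v) \<noteq> 0"
    using fourier_nonzero[of a f] a by blast
  have "char_sum S y * (\<Sum>v\<in>carrier \<Gamma>. \<chi> y v * f v) = (\<Sum>v\<in>carrier \<Gamma>. \<chi> y v * (x * f v))"
    unfolding fourier_convolution[OF S y(1), symmetric] by (intro sum.cong refl) (simp add: f)
  also have "\<dots> = x * (\<Sum>v\<in>carrier \<Gamma>. \<chi> y v * f v)"
    by (simp add: sum_distrib_left mult.left_commute)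
  finally show "\<exists>y\<in>carrier \<Gamma>. x = char_sum S y"
    using y(1) mult_right_cancel[OF y(2)] by metis
next
  assume "\<exists>y\<in>carrier \<Gamma>. x = char_sum S y"
  then obtain y where y: "y \<in> carrier \<Gamma>" "x = char_sum S y"
    by blast
  show "graph_eigenvalue (cayley_graph \<Gamma> S) x"
    unfolding graph_eigenvalue_def cayley_graph_verts
    using y char_nonzero[of y \<one>] S
    by (intro exI[of _ "\<chi> y"]) (auto simp: adj_op_cayley_graph sum_neighbours_char intro!: bexI[of _ \<one>])
qed

section \<open>Spectrum of a Kronecker product with a Cayley graph\<close>

text \<open>A neighbourhood in the product is a product of neighbourhoods, so the sum over it can be
  iterated.\<close>

lemma adj_op_kronecker_cayley:
  assumes u: "u \<in> carrier \<Gamma>" and x: "x \<in> pverts G"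
  shows "adj_op (kronecker_product (cayley_graph \<Gamma> S) G) f (u, x) =
    (\<Sum>v\<in>{v \<in> carrier \<Gamma>. u \<otimes> inv v \<in> S}. adj_op G (\<lambda>w. f (v, w)) x)"
proof -
  have "{v \<in> pverts (kronecker_product (cayley_graph \<Gamma> S) G).
        ((u, x), v) \<in> parcs (kronecker_product (cayley_graph \<Gamma> S) G)} =
      {v \<in> carrier \<Gamma>. u \<otimes> inv v \<in> S} \<times> {w \<in> pverts G. (x, w) \<in> parcs G}"
    using u by (auto simp: kronecker_product_def cayley_graph_def)
  then show ?thesis
    unfolding adj_op_def by (simp add: sum.cartesian_product)
qed

lemma adj_op_sum:
  "adj_op G (\<lambda>w. \<Sum>v\<in>C. c v * f v w) x = (\<Sum>v\<in>C. c v * adj_op G (f v) x)"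
  unfolding adj_op_def sum_distrib_left by (rule sum.swap)

text \<open>The tensor product of \<open>\<chi> y\<close> with an eigenfunction of \<open>G\<close>
  is an eigenfunction of the product graph.\<close>

lemma graph_eigenvalue_kronecker_cayleyI:
  assumes S: "inv_closed S" and ev: "graph_eigenvalue G \<theta>"
    and y: "y \<in> carrier \<Gamma>"
  shows "graph_eigenvalue (kronecker_product (cayley_graph \<Gamma> S) G) (char_sum S y * \<theta>)"
proof -
  obtain f a where a: "a \<in> pverts G" "f a \<noteq> 0"
      and f: "\<And>u. u \<in> pverts G \<Longrightarrow> adj_op G f u = \<theta> * f u"
    using ev unfolding graph_eigenvalue_def by auto
  let ?K = "kronecker_product (cayley_graph \<Gamma> S) G"
  define h where "h = (\<lambda>(v, w). \<chi> y v * f w)"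
  have "h (\<one>, a) \<noteq> 0"
    using a y by (simp add: h_def char_one)
  moreover have "(\<one>, a) \<in> pverts ?K"
    using a by (simp add: kronecker_product_def cayley_graph_def)
  moreover have "adj_op ?K h p = char_sum S y * \<theta> * h p" if p: "p \<in> pverts ?K" for p
  proof -
    obtain u x where ux: "p = (u, x)" "u \<in> carrier \<Gamma>" "x \<in> pverts G"
      using p by (auto simp: kronecker_product_def cayley_graph_def)
    have "adj_op G (\<lambda>w. h (v, w)) x = \<chi> y v * (\<theta> * f x)" for v
      using f[OF ux(3)] by (simp add: h_def adj_op_def sum_distrib_left[symmetric])
    then have "adj_op ?K h p = (\<Sum>v\<in>{v \<in> carrier \<Gamma>. u \<otimes> inv v \<in> S}. \<chi> y v) * (\<theta> * f x)"
      unfolding ux(1) adj_op_kronecker_cayley[OF ux(2,3)] by (simp add: sum_distrib_right)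
    then show ?thesis
      using sum_neighbours_char[OF S ux(2) y] by (simp add: h_def ux(1))
  qed
  ultimately show ?thesis
    unfolding graph_eigenvalue_def by blast
qed

text \<open>A Fourier transform in the first coordinate turns an eigenvector of the product into an
  eigenvector of \<open>G\<close>.\<close>

lemma graph_eigenvalue_kronecker_cayleyE:
  assumes S: "inv_closed S"
    and nz: "\<And>y. y \<in> carrier \<Gamma> \<Longrightarrow> char_sum S y \<noteq> 0"
    and ev: "graph_eigenvalue (kronecker_product (cayley_graph \<Gamma> S) G) z"
  obtains y \<theta> where "y \<in> carrier \<Gamma>" "graph_eigenvalue G \<theta>" "z = char_sum S y * \<theta>"
proof -
  let ?C = "carrier \<Gamma>" and ?K = "kronecker_product (cayley_graph \<Gamma> S) G"
  have K: "pverts ?K = ?C \<times> pverts G"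
    by (simp add: kronecker_product_def cayley_graph_def)
  obtain f p where p: "p \<in> pverts ?K" "f p \<noteq> 0"
      and f: "\<And>q. q \<in> pverts ?K \<Longrightarrow> adj_op ?K f q = z * f q"
    using ev unfolding graph_eigenvalue_def by auto
  obtain a b where ab: "p = (a, b)" "a \<in> ?C" "b \<in> pverts G"
    using p(1) unfolding K by auto
  \<comment> \<open>With the second coordinate frozen at \<open>b\<close>, this choice of
    \<open>y\<close> ensures that \<open>h\<close> below is nonzero at \<open>b\<close>.\<close>
  obtain y where y: "y \<in> ?C" "(\<Sum>v\<in>?C. \<chi> y v * f (v, b)) \<noteq> 0"
    using fourier_nonzero[of a "\<lambda>v. f (v, b)"] ab p(2) by auto
  define h where "h = (\<lambda>x. \<Sum>v\<in>?C. \<chi> y v * f (v, x))"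
  have "adj_op G h x = z / char_sum S y * h x" if x: "x \<in> pverts G" for x
  proof -
    have "char_sum S y * adj_op G h x =
        char_sum S y * (\<Sum>v\<in>?C. \<chi> y v * adj_op G (\<lambda>w. f (v, w)) x)"
      unfolding h_def adj_op_sum ..
    also have "\<dots> = (\<Sum>u\<in>?C. \<chi> y u * adj_op ?K f (u, x))"
      unfolding fourier_convolution[OF S y(1), symmetric]
      by (intro sum.cong) (auto simp: adj_op_kronecker_cayley[OF _ x])
    also have "\<dots> = z * h x"
      unfolding h_def sum_distrib_left using x by (intro sum.cong) (auto simp: f K)
    \<comment> \<open>Dividing by the nonzero \<open>char_sum S y\<close> gives the eigenvalue
      equation for \<open>h\<close>.\<close>
    finally show ?thesis
      using nz[OF y(1)] by (simp add: field_simps)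
  qed
  then have "graph_eigenvalue G (z / char_sum S y)"
    unfolding graph_eigenvalue_def using ab(3) y(2)
    by (intro exI[of _ h] conjI bexI[of _ b]) (simp_all add: h_def)
  then show thesis
    using that[OF y(1)] nz[OF y(1)] by simp
qed

section \<open>Spectral form of the transition matrix\<close>

text \<open>Spectral decomposition in the orthogonal basis of characters. The column vertex
  \<open>v\<close> varies in the induction because the last factor of the power passes from
  \<open>v\<close> to its neighbours.\<close>

lemma adj_mat_pow_cayley_graph:
  assumes S: "inv_closed S" and uv: "u \<in> carrier \<Gamma>" "v \<in> carrier \<Gamma>"
  shows "(adj_mat (cayley_graph \<Gamma> S) ^\<^sub>m n) $$
      (to_nat_on (carrier \<Gamma>) u, to_nat_on (carrier \<Gamma>) v) =
    (\<Sum>y\<in>carrier \<Gamma>. char_sum S y ^ n * (\<chi> y u * cnj (\<chi> y v))) / of_nat (card (carrier \<Gamma>))"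
  using uv(2)
proof (induction n arbitrary: v)
  case 0
  have inj: "to_nat_on (carrier \<Gamma>) u = to_nat_on (carrier \<Gamma>) v \<longleftrightarrow> u = v"
    using uv(1) 0 finite_carrier by (simp add: countable_finite)
  show ?case
    using uv(1) 0 adj_mat_carrier[of "cayley_graph \<Gamma> S"]
    by (auto simp: char_orthogonality to_nat_on_less finite_carrier inj cayley_graph_verts)
next
  case (Suc n)
  let ?C = "carrier \<Gamma>" and ?A = "adj_mat (cayley_graph \<Gamma> S)" and ?i = "to_nat_on (carrier \<Gamma>)"
  let ?N = "{w \<in> carrier \<Gamma>. v \<otimes> inv w \<in> S}"
  have A: "?A ^\<^sub>m n \<in> carrier_mat (card ?C) (card ?C)"
    using adj_mat_carrier[of "cayley_graph \<Gamma> S"] by (simp add: cayley_graph_verts)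
  have N: "{w \<in> ?C. (w, v) \<in> parcs (cayley_graph \<Gamma> S)} = ?N"
    using Suc.prems inv_closed_commute[OF S] by (auto simp: cayley_graph_arcs)
  have "(?A ^\<^sub>m Suc n) $$ (?i u, ?i v) = (\<Sum>w\<in>?N. (?A ^\<^sub>m n) $$ (?i u, ?i w))"
    using mult_adj_mat_entry[of "cayley_graph \<Gamma> S" v "?A ^\<^sub>m n" "?i u"] A N Suc.prems uv(1)
    by (simp add: cayley_graph_verts finite_carrier to_nat_on_less)
  also have "\<dots> = (\<Sum>w\<in>?N. (\<Sum>y\<in>?C. char_sum S y ^ n * (\<chi> y u * cnj (\<chi> y w))) / of_nat (card ?C))"
    by (intro sum.cong) (auto simp: Suc.IH)
  also have "\<dots> = (\<Sum>y\<in>?C. char_sum S y ^ n * (\<chi> y u * cnj (\<Sum>w\<in>?N. \<chi> y w))) / of_nat (card ?C)"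
    unfolding sum_divide_distrib[symmetric] cnj_sum sum_distrib_left by (subst sum.swap) (rule refl)
  \<comment> \<open>The new eigenvalue appears conjugated; it is real by
    \<open>char_sum_real\<close>.\<close>
  also have "(\<Sum>y\<in>?C. char_sum S y ^ n * (\<chi> y u * cnj (\<Sum>w\<in>?N. \<chi> y w))) =
      (\<Sum>y\<in>?C. char_sum S y ^ Suc n * (\<chi> y u * cnj (\<chi> y v)))"
    using S Suc.prems
    by (intro sum.cong) (auto simp: sum_neighbours_char char_sum_real mult_ac)
  finally show ?case .
qed

text \<open>The exponential series is summed separately for each character, which is legitimate
  since there are finitely many.\<close>

lemma transition_entry_cayley_graph:
  assumes S: "inv_closed S" and uv: "u \<in> carrier \<Gamma>" "v \<in> carrier \<Gamma>"
  shows "transition_entry (cayley_graph \<Gamma> S) t u v =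
    (\<Sum>y\<in>carrier \<Gamma>. exp (\<i> * of_real t * char_sum S y) * (\<chi> y u * cnj (\<chi> y v))) /
      of_nat (card (carrier \<Gamma>))"
proof -
  let ?C = "carrier \<Gamma>"
  let ?N = "of_nat (card ?C) :: complex"
  have series: "(\<lambda>n. (\<i> * of_real t * char_sum S y) ^ n / fact n * (\<chi> y u * cnj (\<chi> y v)))
      sums (exp (\<i> * of_real t * char_sum S y) * (\<chi> y u * cnj (\<chi> y v)))" for y
  proof (rule sums_mult2)
    show "(\<lambda>n. (\<i> * of_real t * char_sum S y) ^ n / fact n) sums
        exp (\<i> * of_real t * char_sum S y)"
      using exp_converges[of "\<i> * of_real t * char_sum S y"]
      by (simp add: scaleR_conv_of_real divide_inverse mult.commute)
  qed
  have "(\<lambda>n. (\<Sum>y\<in>?C. (\<i> * of_real t * char_sum S y) ^ n / fact n * (\<chi> y u * cnj (\<chi> y v))) / ?N)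
      sums ((\<Sum>y\<in>?C. exp (\<i> * of_real t * char_sum S y) * (\<chi> y u * cnj (\<chi> y v))) / ?N)"
    by (intro sums_divide sums_sum series)
  moreover have "(\<i> * of_real t) ^ n * (adj_mat (cayley_graph \<Gamma> S) ^\<^sub>m n) $$
        (to_nat_on ?C u, to_nat_on ?C v) / fact n =
      (\<Sum>y\<in>?C. (\<i> * of_real t * char_sum S y) ^ n / fact n * (\<chi> y u * cnj (\<chi> y v))) / ?N" for n
    unfolding adj_mat_pow_cayley_graph[OF S uv]
    by (simp add: sum_distrib_left sum_divide_distrib power_mult_distrib mult_ac)
  ultimately show ?thesis
    using transition_entry_eq[of "cayley_graph \<Gamma> S" u v t] uv
    by (simp add: cayley_graph_verts finite_carrier sums_iff)
qed

section \<open>Periodicity and perfect state transfer as phase conditions\<close>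

lemma norm_exp_char_sum:
  assumes "inv_closed S" "y \<in> carrier \<Gamma>"
  shows "cmod (exp (\<i> * of_real t * char_sum S y)) = 1"
proof -
  have "Im (char_sum S y) = 0"
    using char_sum_real[OF assms] by (simp add: complex_eq_iff)
  then show ?thesis
    by simp
qed

text \<open>The entry is an average of unimodular numbers, so modulus 1 forces them all to agree.
  The index \<open>\<one>\<close> serves as reference because its character is identically
  1.\<close>

lemma norm_transition_entry_eq_1D:
  assumes S: "inv_closed S" and uv: "u \<in> carrier \<Gamma>" "v \<in> carrier \<Gamma>"
    and 1: "cmod (transition_entry (cayley_graph \<Gamma> S) t u v) = 1" and y: "y \<in> carrier \<Gamma>"
  shows "exp (\<i> * of_real t * char_sum S y) * (\<chi> y u * cnj (\<chi> y v)) =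
    exp (\<i> * of_real t * char_sum S \<one>)"
proof -
  let ?f = "\<lambda>y. exp (\<i> * of_real t * char_sum S y) * (\<chi> y u * cnj (\<chi> y v))"
  have "?f y = ?f \<one>"
  proof (rule norm_sum_eq_card_imp_const[OF finite_carrier])
    show "cmod (?f y) = 1" if "y \<in> carrier \<Gamma>" for y
      using norm_exp_char_sum[OF S that] uv that by (simp add: norm_mult norm_char)
    show "cmod (\<Sum>y\<in>carrier \<Gamma>. ?f y) = real (card (carrier \<Gamma>))"
      using 1 card_carrier_pos unfolding transition_entry_cayley_graph[OF S uv]
      by (simp add: norm_divide field_simps)
  qed (use y in auto)
  then show ?thesis
    using uv by (simp add: trivial_char)
qed

text \<open>On the diagonal the factors \<open>\<chi> y u * cnj (\<chi> y u)\<close> are 1, so only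
  the phases of the eigenvalues remain. The diagonal entry at \<open>\<one>\<close> already
  determines whether they agree.\<close>

lemma periodic_at_cayley_graph_iff:
  assumes S: "inv_closed S"
  shows "periodic_at (cayley_graph \<Gamma> S) t \<longleftrightarrow>
    (\<exists>c. \<forall>y\<in>carrier \<Gamma>. exp (\<i> * of_real t * char_sum S y) = c)"
    (is "_ \<longleftrightarrow> ?const")
proof
  assume "periodic_at (cayley_graph \<Gamma> S) t"
  then have "cmod (transition_entry (cayley_graph \<Gamma> S) t \<one> \<one>) = 1"
    by (simp add: periodic_at_def cayley_graph_verts)
  from norm_transition_entry_eq_1D[OF S one_closed one_closed this]
  have "exp (\<i> * of_real t * char_sum S y) = exp (\<i> * of_real t * char_sum S \<one>)"
    if "y \<in> carrier \<Gamma>" for y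
    using that char_one[OF that] by (metis complex_cnj_one mult_1_right)
  then show ?const
    by blast
next
  assume ?const
  then obtain c where const: "\<And>y. y \<in> carrier \<Gamma> \<Longrightarrow> exp (\<i> * of_real t * char_sum S y) = c"
    by blast
  have "transition_entry (cayley_graph \<Gamma> S) t u u = c" if u: "u \<in> carrier \<Gamma>" for u
  proof -
    have "transition_entry (cayley_graph \<Gamma> S) t u u =
        (\<Sum>y\<in>carrier \<Gamma>. c) / of_nat (card (carrier \<Gamma>))"
      unfolding transition_entry_cayley_graph[OF S u u]
      using const u by (intro arg_cong2[of _ _ _ _ "(/)"] sum.cong) (auto simp: char_mult_cnj)
    then show ?thesis
      using card_carrier_pos finite_carrier by auto
  qed
  then show "periodic_at (cayley_graph \<Gamma> S) t"
    using norm_exp_char_sum[OF S one_closed, of t]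
    unfolding periodic_at_def cayley_graph_verts const[OF one_closed] by simp
qed

text \<open>A common phase at time \<open>t\<close> becomes its \<open>n\<close>-th power at time
  \<open>n\<close> times \<open>t\<close>.\<close>

lemma periodic_at_cayley_graph_mult:
  assumes S: "inv_closed S" and "periodic_at (cayley_graph \<Gamma> S) t"
  shows "periodic_at (cayley_graph \<Gamma> S) (of_nat n * t)"
proof -
  have "exp (\<i> * of_real (of_nat n * t) * char_sum S y) = exp (\<i> * of_real t * char_sum S y) ^ n" for y
    by (simp add: exp_of_nat_mult[symmetric] mult_ac)
  then show ?thesis
    using assms(2) unfolding periodic_at_cayley_graph_iff[OF S] by fastforce
qed

text \<open>The eigenvalues are real, so conjugating the phase relation shows that the phases
  \<open>\<chi> y u * cnj (\<chi> y v)\<close> are \<open>\<plusminus>1\<close>; they disappear when the time is doubled.\<close>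

lemma perfect_state_transfer_imp_periodic:
  assumes S: "inv_closed S" and "perfect_state_transfer_at (cayley_graph \<Gamma> S) t"
  shows "periodic_at (cayley_graph \<Gamma> S) (2 * t)"
proof -
  obtain u v where u: "u \<in> carrier \<Gamma>" and v: "v \<in> carrier \<Gamma>"
      and 1: "cmod (transition_entry (cayley_graph \<Gamma> S) t u v) = 1"
    using assms(2) unfolding perfect_state_transfer_at_def cayley_graph_verts by blast
  define e where "e y = exp (\<i> * of_real t * char_sum S y)" for y
  define p where "p y = \<chi> y u * cnj (\<chi> y v)" for y
  have ep: "e y * p y = e \<one>" if "y \<in> carrier \<Gamma>" for y
    using norm_transition_entry_eq_1D[OF S u v 1 that] by (simp add: e_def p_def)
  have e2: "e y ^ 2 = e \<one> ^ 2" if y: "y \<in> carrier \<Gamma>" for y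
  proof -
    \<comment> \<open>Passing to the index \<open>inv y\<close> keeps the real eigenvalue and
      conjugates the phase \<open>p\<close>, which yields a second relation with the same right-hand
      side.\<close>
    have "char_sum S (inv y) = cnj (char_sum S y)"
      using S y unfolding char_sum_def cnj_sum inv_closed_def
      by (intro sum.cong) (auto simp: char_inv_index)
    then have "e (inv y) = e y"
      using char_sum_real[OF S y] by (simp add: e_def)
    moreover have "p (inv y) = cnj (p y)"
      using y u v by (simp add: p_def char_inv_index)
    ultimately have "e y * cnj (p y) = e \<one>"
      using ep[of "inv y"] y by simp
    \<comment> \<open>In the product of the two relations \<open>p y\<close> meets its conjugate and
      disappears.\<close>
    then have "e \<one> ^ 2 = (e y * p y) * (e y * cnj (p y))"
      using ep[OF y] by (simp add: power2_eq_square)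
    also have "\<dots> = e y ^ 2 * ((\<chi> y u * cnj (\<chi> y u)) * (\<chi> y v * cnj (\<chi> y v)))"
      by (simp add: p_def power2_eq_square mult_ac)
    finally show ?thesis
      using y u v by (simp add: char_mult_cnj)
  qed
  have "exp (\<i> * of_real (2 * t) * char_sum S y) = e y ^ 2" for y
    by (simp add: e_def exp_double[symmetric] mult_ac)
  then show ?thesis
    using e2 unfolding periodic_at_cayley_graph_iff[OF S] by metis
qed

section \<open>Disjoint unions of connection sets\<close>

lemma char_sum_Un_disjoint:
  assumes "inv_closed S" "inv_closed T" "S \<inter> T = {}"
  shows "char_sum (S \<union> T) y = char_sum S y + char_sum T y"
  using assms finite_carrier unfolding char_sum_def inv_closed_def
  by (intro sum.union_disjoint) (auto intro: finite_subset)

lemma inv_closed_Un: "\<lbrakk>inv_closed S; inv_closed T\<rbrakk> \<Longrightarrow> inv_closed (S \<union> T)"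
  by (auto simp: inv_closed_def)

text \<open>Eigenvalues add, so phases multiply; those of \<open>S\<close> all equal one nonzero
  constant \<open>c\<close>, which cancels.\<close>

lemma periodic_at_Un_iff:
  assumes S: "inv_closed S" and T: "inv_closed T" and disj: "S \<inter> T = {}"
    and per: "periodic_at (cayley_graph \<Gamma> S) t"
  shows "periodic_at (cayley_graph \<Gamma> (S \<union> T)) t \<longleftrightarrow> periodic_at (cayley_graph \<Gamma> T) t"
proof -
  obtain c where c: "\<And>y. y \<in> carrier \<Gamma> \<Longrightarrow> exp (\<i> * of_real t * char_sum S y) = c"
    using per unfolding periodic_at_cayley_graph_iff[OF S] by blast
  have "c \<noteq> 0"
    using c[OF one_closed] exp_not_eq_zero by metis
  have prod: "exp (\<i> * of_real t * char_sum (S \<union> T) y) = c * exp (\<i> * of_real t * char_sum T y)"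
    if "y \<in> carrier \<Gamma>" for y
    unfolding char_sum_Un_disjoint[OF S T disj] distrib_left exp_add c[OF that] ..
  have "(\<exists>d. \<forall>y\<in>carrier \<Gamma>. exp (\<i> * of_real t * char_sum (S \<union> T) y) = d) \<longleftrightarrow>
      (\<exists>d. \<forall>y\<in>carrier \<Gamma>. c * exp (\<i> * of_real t * char_sum T y) = d)"
    by (simp add: prod)
  also have "\<dots> \<longleftrightarrow> (\<exists>c. \<forall>y\<in>carrier \<Gamma>. exp (\<i> * of_real t * char_sum T y) = c)"
    using \<open>c \<noteq> 0\<close> by (metis mult_left_cancel)
  finally show ?thesis
    unfolding periodic_at_cayley_graph_iff[OF inv_closed_Un[OF S T]]
      periodic_at_cayley_graph_iff[OF T] .
qed

section \<open>Groups of exponent two\<close>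

lemma inv_closed_involutive:
  assumes "\<And>a. a \<in> carrier \<Gamma> \<Longrightarrow> a \<otimes> a = \<one>" "S \<subseteq> carrier \<Gamma>"
  shows "inv_closed S"
  unfolding inv_closed_def
proof (intro conjI ballI assms(2))
  fix s assume "s \<in> S"
  then have "inv s = s"
    using assms by (intro inv_equality) auto
  then show "inv s \<in> S"
    using \<open>s \<in> S\<close> by simp
qed

text \<open>Each character value squares to 1, so the sum consists of \<open>card S\<close> signs,
  and each sign changes the parity.\<close>

lemma char_sum_involutive:
  assumes "\<And>a. a \<in> carrier \<Gamma> \<Longrightarrow> a \<otimes> a = \<one>" "S \<subseteq> carrier \<Gamma>" "y \<in> carrier \<Gamma>"
  obtains z :: int where "char_sum S y = of_int z" "even z \<longleftrightarrow> even (card S)"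
proof -
  have pm: "\<chi> y s = 1 \<or> \<chi> y s = -1" if "s \<in> carrier \<Gamma>" for s
  proof -
    have "\<chi> y s * \<chi> y s = 1"
      using char_mult[of y s s] assms(1)[OF that] assms(3) that by (simp add: char_one)
    then show ?thesis
      by (simp add: square_eq_1_iff)
  qed
  have "finite S"
    using assms(2) finite_carrier by (rule finite_subset)
  then have "\<exists>z :: int. char_sum S y = of_int z \<and> (even z \<longleftrightarrow> even (card S))"
    using assms(2)
  proof (induction S)
    case empty
    then show ?case
      by (intro exI[of _ 0]) (simp add: char_sum_def)
  next
    case (insert s S)
    then obtain z :: int where z: "char_sum S y = of_int z" "even z \<longleftrightarrow> even (card S)"
      by auto
    have sum: "char_sum (insert s S) y = \<chi> y s + of_int z"
      using insert.hyps z(1) by (simp add: char_sum_def)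
    show ?case
    proof (cases "\<chi> y s = 1")
      case True
      then show ?thesis
        using sum z(2) insert.hyps by (intro exI[of _ "1 + z"]) simp
    next
      case False
      then have "\<chi> y s = -1"
        using pm[of s] insert.prems by simp
      then show ?thesis
        using sum z(2) insert.hyps by (intro exI[of _ "-1 + z"]) simp
    qed
  qed
  with that show thesis
    by blast
qed

end

section \<open>Sums of cyclic groups and gcd-sets\<close>

text \<open>The standard self-pairing of a sum of cyclic groups, written with integer
  representatives and visibly symmetric in \<open>y\<close> and \<open>x\<close>.\<close>

definition cyclic_char :: "nat list \<Rightarrow> (nat \<Rightarrow> int) \<Rightarrow> (nat \<Rightarrow> int) \<Rightarrow> complex" where
  "cyclic_char m y x = (\<Prod>i<length m. cis (2 * pi * of_int (y i * x i) / of_nat (m ! i)))"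

lemma carrier_cyclic_sum:
  assumes "\<forall>i<length m. 0 < m ! i"
  shows "carrier (cyclic_sum m) = (\<Pi>\<^sub>E i\<in>{..<length m}. {0..<int (m ! i)})"
  using assms unfolding cyclic_sum_def
  by (auto simp: carrier_integer_mod_group intro!: PiE_cong)

text \<open>Reducing \<open>a\<close> modulo \<open>n\<close> changes the angle by an integer
  multiple of \<open>2 * pi\<close>. This makes the characters compatible with addition of
  representatives.\<close>

lemma cis_mod:
  assumes "0 < n"
  shows "cis (2 * pi * of_int (y * (a mod int n)) / of_nat n) = cis (2 * pi * of_int (y * a) / of_nat n)"
proof -
  have "real_of_int (y * a) = real_of_int (y * (a mod int n)) + real_of_int (y * (a div int n)) * real n"
    by (metis (no_types) of_int_add of_int_mult of_int_of_nat_eq distrib_left mod_div_mult_eq mult.assoc)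
  then have "2 * pi * of_int (y * a) / of_nat n =
      2 * pi * of_int (y * (a mod int n)) / of_nat n + 2 * pi * real_of_int (y * (a div int n))"
    using assms by (simp add: field_simps)
  then show ?thesis
    by (simp only: cis_mult[symmetric] cis_multiple_2pi Ints_of_int mult_1_right)
qed

text \<open>A geometric sum of an \<open>n\<close>-th root of unity \<open>w\<close>; the range of
  \<open>x\<close> excludes \<open>w = 1\<close>.\<close>

lemma sum_cis_eq_0:
  assumes "0 < x" "x < int n"
  shows "(\<Sum>y\<in>{0..<int n}. cis (2 * pi * of_int (y * x) / of_nat n)) = 0"
proof -
  define w where "w = cis (2 * pi * of_int x / of_nat n)"
  have n: "0 < n"
    using assms by simp
  have "w ^ n = 1"
    using n by (simp add: w_def DeMoivre cis_multiple_2pi)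
  moreover have "w \<noteq> 1"
  proof
    assume "w = 1"
    then have "cos (2 * pi * of_int x / of_nat n) = 1"
      by (simp add: w_def complex_eq_iff)
    then obtain j :: int where "2 * pi * of_int x / of_nat n = of_int j * 2 * pi"
      using cos_one_2pi_int by auto
    then have "real_of_int x = of_int (j * int n)"
      using n by (simp add: field_simps)
    then have "x = j * int n"
      by linarith
    with assms n show False
      by (metis dvd_triv_right zdvd_not_zless)
  qed
  moreover have "(\<Sum>y\<in>{0..<int n}. cis (2 * pi * of_int (y * x) / of_nat n)) = (\<Sum>k<n. w ^ k)"
  proof (rule sum.reindex_bij_witness[where i = int and j = nat])
    fix y assume "y \<in> {0..<int n}"
    then show "w ^ nat y = cis (2 * pi * of_int (y * x) / of_nat n)"
      by (simp add: w_def DeMoivre mult_ac)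
  qed auto
  ultimately show ?thesis
    by (simp add: geometric_sum)
qed

lemma self_dual_group_cyclic_sum:
  assumes pos: "\<forall>i<length m. 0 < m ! i"
  shows "self_dual_group (cyclic_sum m) (cyclic_char m)"
proof -
  interpret group "cyclic_sum m"
    unfolding cyclic_sum_def by simp
  show ?thesis
  proof
    show "finite (carrier (cyclic_sum m))"
      unfolding carrier_cyclic_sum[OF pos] by (intro finite_PiE) auto
    show "x \<otimes>\<^bsub>cyclic_sum m\<^esub> y = y \<otimes>\<^bsub>cyclic_sum m\<^esub> x" for x y
      by (simp add: cyclic_sum_def add.commute)
    show "cmod (cyclic_char m y a) = 1" for y a
      by (simp add: cyclic_char_def prod_norm[symmetric])
    show "cyclic_char m y a = cyclic_char m a y" for y a
      by (simp add: cyclic_char_def mult.commute)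
    show "cyclic_char m y (a \<otimes>\<^bsub>cyclic_sum m\<^esub> b) = cyclic_char m y a * cyclic_char m y b" for y a b
      unfolding cyclic_char_def prod.distrib[symmetric]
    proof (intro prod.cong refl)
      fix i assume "i \<in> {..<length m}"
      then have i: "i < length m" "0 < m ! i"
        using pos by auto
      have "(a \<otimes>\<^bsub>cyclic_sum m\<^esub> b) i = (a i + b i) mod int (m ! i)"
        using i by (simp add: cyclic_sum_def)
      then show "cis (2 * pi * of_int (y i * (a \<otimes>\<^bsub>cyclic_sum m\<^esub> b) i) / of_nat (m ! i)) =
          cis (2 * pi * of_int (y i * a i) / of_nat (m ! i)) *
          cis (2 * pi * of_int (y i * b i) / of_nat (m ! i))"
        by (simp only: cis_mod[OF i(2)] cis_mult) (simp add: distrib_left add_divide_distrib)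
    qed
    fix a assume a: "a \<in> carrier (cyclic_sum m)" "a \<noteq> \<one>\<^bsub>cyclic_sum m\<^esub>"
    have range: "0 \<le> a i \<and> a i < int (m ! i)" if "i < length m" for i
      using a(1) that unfolding carrier_cyclic_sum[OF pos] by (auto simp: PiE_iff)
    \<comment> \<open>A nontrivial element has a nonzero coordinate; outside the index range
      extensionality already fixes its values.\<close>
    obtain j where j: "j < length m" "a j \<noteq> 0"
    proof (rule ccontr)
      assume "\<not> thesis"
      then have "a i = \<one>\<^bsub>cyclic_sum m\<^esub> i" for i
        using that a(1) unfolding carrier_cyclic_sum[OF pos]
        by (cases "i < length m") (auto simp: cyclic_sum_def PiE_iff extensional_def)
      with a(2) show False
        by auto
    qed
    \<comment> \<open>The sum over the product set factors into one sum per coordinate, and the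
      factor at \<open>j\<close> vanishes.\<close>
    have "(\<Sum>y\<in>carrier (cyclic_sum m). cyclic_char m y a) =
        (\<Prod>i<length m. \<Sum>y\<in>{0..<int (m ! i)}. cis (2 * pi * of_int (y * a i) / of_nat (m ! i)))"
      unfolding cyclic_char_def carrier_cyclic_sum[OF pos] by (subst prod_sum_PiE) auto
    also have "\<dots> = 0"
      using j range[OF j(1)] sum_cis_eq_0[of "a j" "m ! j"] by (intro prod_zero bexI[of _ j]) auto
    finally show "(\<Sum>y\<in>carrier (cyclic_sum m). cyclic_char m y a) = 0" .
  qed
qed

section \<open>Gcd-sets as connection sets\<close>

lemma gcd_set_subset: "gcd_set m D \<subseteq> carrier (cyclic_sum m)"
  by (auto simp: gcd_set_def gcd_class_def)

text \<open>Inversion is coordinatewise negation followed by reduction, and the gcd with the modulus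
  ignores both.\<close>

lemma inv_gcd_set:
  assumes pos: "\<forall>i<length m. 0 < m ! i" and x: "x \<in> gcd_set m D"
  shows "inv\<^bsub>cyclic_sum m\<^esub> x \<in> gcd_set m D"
proof -
  interpret group "cyclic_sum m"
    unfolding cyclic_sum_def by simp
  obtain d where d: "d \<in> D" "x \<in> carrier (cyclic_sum m)"
      and gcd: "\<And>i. i < length m \<Longrightarrow> gcd (x i) (int (m ! i)) = int (d ! i)"
    using x by (auto simp: gcd_set_def gcd_class_def)
  have "gcd ((inv\<^bsub>cyclic_sum m\<^esub> x) i) (int (m ! i)) = int (d ! i)" if "i < length m" for i
  proof -
    have "x i \<in> carrier (integer_mod_group (m ! i))"
      using d(2) that unfolding cyclic_sum_def by (auto simp: PiE_iff)
    then have "(inv\<^bsub>cyclic_sum m\<^esub> x) i = (- x i) mod int (m ! i)"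
      using d(2) that unfolding cyclic_sum_def by simp
    then show ?thesis
      using gcd[OF that] pos that by (simp add: gcd_mod_left)
  qed
  then show ?thesis
    using d unfolding gcd_set_def gcd_class_def by auto
qed

lemma gcd_set_Un: "gcd_set m (D \<union> D') = gcd_set m D \<union> gcd_set m D'"
  by (auto simp: gcd_set_def)

text \<open>An element \<open>x\<close> determines its divisor tuple through the gcds of its
  coordinates, so it lies in the class of only one tuple.\<close>

lemma gcd_set_disjoint:
  assumes "\<forall>d\<in>D. length d = length m" "\<forall>d\<in>D'. length d = length m" "D \<inter> D' = {}"
  shows "gcd_set m D \<inter> gcd_set m D' = {}"
proof (rule ccontr)
  assume "gcd_set m D \<inter> gcd_set m D' \<noteq> {}"
  then obtain x d d' where d: "d \<in> D" "d' \<in> D'" "x \<in> gcd_class m d" "x \<in> gcd_class m d'"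
    by (auto simp: gcd_set_def)
  then have "\<forall>i<length m. int (d ! i) = int (d' ! i)"
    unfolding gcd_class_def by auto
  then have "d = d'"
    using assms(1,2) d(1,2) by (intro nth_equalityI) auto
  with assms(3) d(1,2) show False
    by blast
qed

section \<open>Parity of eigenvalues\<close>

lemma exp_pi_of_int:
  "exp (\<i> * of_real pi * of_int z) = (if even z then 1 else - 1)"
proof -
  have "exp (\<i> * of_real pi * of_int z) = cis (pi * of_int z)"
    by (simp add: cis_conv_exp mult.assoc)
  also have "\<dots> = (if even z then 1 else - 1)"
    by (simp add: complex_eq_iff cos_npi_int sin_npi_int)
  finally show ?thesis .
qed

lemma finite_pverts_integral_graph: "integral_graph G \<Longrightarrow> finite (pverts G)"
  by (simp add: integral_graph_def pair_pseudo_graph_def pair_fin_digraph.pair_finite_verts)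

lemma graph_eigenvalue_integral_graph:
  assumes "integral_graph G" "graph_eigenvalue G x"
  shows "\<exists>z :: int. x = of_int z"
  using assms eigenvalue_adj_mat_iff[OF finite_pverts_integral_graph[OF assms(1)]]
  unfolding integral_graph_def Ints_def by blast

text \<open>At an integer \<open>z\<close> the phase at time \<open>pi\<close> is
  \<open>(- 1) ^ z\<close>. Equal parity thus takes the same shape as the periodicity
  criterion.\<close>

lemma eigenvalues_same_parity_iff:
  assumes "integral_graph G"
  shows "eigenvalues_same_parity G \<longleftrightarrow>
    (\<exists>c. \<forall>x. graph_eigenvalue G x \<longrightarrow> exp (\<i> * of_real pi * x) = c)"
proof -
  note ev = eigenvalue_adj_mat_iff[OF finite_pverts_integral_graph[OF assms]]
    and int = graph_eigenvalue_integral_graph[OF assms]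
  have one: "exp (\<i> * of_real pi * x) = 1 \<longleftrightarrow> (\<exists>z :: int. x = of_int z \<and> even z)"
    and minus_one: "exp (\<i> * of_real pi * x) = - 1 \<longleftrightarrow> (\<exists>z :: int. x = of_int z \<and> odd z)"
    if "graph_eigenvalue G x" for x
    using int[OF that] by (auto simp: exp_pi_of_int split: if_splits)
  show ?thesis
  proof
    assume "eigenvalues_same_parity G"
    then show "\<exists>c. \<forall>x. graph_eigenvalue G x \<longrightarrow> exp (\<i> * of_real pi * x) = c"
      unfolding eigenvalues_same_parity_def ev
    proof
      assume "\<forall>x. graph_eigenvalue G x \<longrightarrow> (\<exists>z :: int. x = of_int z \<and> even z)"
      then show ?thesis
        using one by (intro exI[of _ 1]) simp
    next
      assume "\<forall>x. graph_eigenvalue G x \<longrightarrow> (\<exists>z :: int. x = of_int z \<and> odd z)"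
      then show ?thesis
        using minus_one by (intro exI[of _ "- 1"]) simp
    qed
  next
    assume "\<exists>c. \<forall>x. graph_eigenvalue G x \<longrightarrow> exp (\<i> * of_real pi * x) = c"
    then obtain c where c: "\<And>x. graph_eigenvalue G x \<Longrightarrow> exp (\<i> * of_real pi * x) = c"
      by blast
    show "eigenvalues_same_parity G"
    proof (cases "c = 1")
      case True
      then show ?thesis
        unfolding eigenvalues_same_parity_def ev using c one by simp
    next
      case False
      \<comment> \<open>The claim is conditional on an eigenvalue: for a graph without vertices
        there is none, and \<open>c\<close> is arbitrary.\<close>
      have "c = - 1" if "graph_eigenvalue G x" for x
        using int[OF that] c[OF that] False by (auto simp: exp_pi_of_int split: if_splits)
      then show ?thesis
        unfolding eigenvalues_same_parity_def ev using c minus_one by simp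
    qed
  qed
qed

text \<open>The eigenvalues of \<open>X(C')\<close> are odd, so passing from \<open>G\<close> to the product does not change the
  set of parities of eigenvalues.\<close>

lemma kronecker_cubelike_parity:
  assumes C: "C \<subseteq> carrier (cyclic_sum (replicate N 2))" "odd (card C)" and G: "integral_graph G"
  shows "(\<forall>x. graph_eigenvalue (kronecker_product (cubelike_graph N C) G) x \<longrightarrow>
      exp (\<i> * of_real pi * x) = c) \<longleftrightarrow>
    (\<forall>x. graph_eigenvalue G x \<longrightarrow> exp (\<i> * of_real pi * x) = c)"
proof -
  let ?Z = "cyclic_sum (replicate N 2)"
  have pos: "\<forall>i<length (replicate N 2). 0 < replicate N (2 :: nat) ! i"
    by simp
  interpret self_dual_group ?Z "cyclic_char (replicate N 2)"
    by (rule self_dual_group_cyclic_sum[OF pos])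
  have invol: "a \<otimes>\<^bsub>?Z\<^esub> a = \<one>\<^bsub>?Z\<^esub>" for a
    unfolding cyclic_sum_def by (auto simp: fun_eq_iff)
  note SC = inv_closed_involutive[OF invol C(1)]
  note int = graph_eigenvalue_integral_graph[OF G]
  have odd: "\<exists>z :: int. char_sum C y = of_int z \<and> odd z" if "y \<in> carrier ?Z" for y
    using char_sum_involutive[OF invol C(1) that] C(2) by blast
  have nz: "char_sum C y \<noteq> 0" if "y \<in> carrier ?Z" for y
    using odd[OF that] by fastforce
  \<comment> \<open>For odd \<open>z\<close> the integers \<open>z * t\<close> and \<open>t\<close>
    have the same parity.\<close>
  have same: "exp (\<i> * of_real pi * (char_sum C y * x)) = exp (\<i> * of_real pi * x)"
    if y: "y \<in> carrier ?Z" and x: "graph_eigenvalue G x" for x y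
  proof -
    obtain z t :: int where "char_sum C y = of_int z" "odd z" "x = of_int t"
      using odd[OF y] int[OF x] by blast
    then show ?thesis
      using exp_pi_of_int[of "z * t"] exp_pi_of_int[of t] by simp
  qed
  \<comment> \<open>To reach every eigenvalue of \<open>G\<close> from the product, the trivial
    character of the cubelike factor suffices.\<close>
  show ?thesis
    unfolding cubelike_graph_def
    using graph_eigenvalue_kronecker_cayleyI[OF SC _ one_closed]
      graph_eigenvalue_kronecker_cayleyE[OF SC nz] same one_closed
    by metis
qed

section \<open>Periodicity of the union at time pi\<close>

theorem theorem4p15:
  fixes ns ps ms m ds :: "nat list"
    and D D' :: "nat list set"
    and k N :: nat
    and C' :: "(nat \<Rightarrow> int) set"
    and G :: "'g pair_pre_digraph"
  assumes "length ps = length ms"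
    and "\<forall>p\<in>set ps. prime p \<and> 2 < p"
    and "m = map (\<lambda>n. 2 ^ n) ns @ map2 (\<lambda>p j. p ^ j) ps ms"
    and "\<forall>d\<in>D. divisor_tuple m d"
    and "0 < k"
    and "perfect_state_transfer_at (cayley_graph (cyclic_sum m) (gcd_set m D)) (pi / 2 ^ k)"
    and "divisor_tuple (map2 (\<lambda>p j. p ^ j) ps ms) ds"
    and "\<forall>d\<in>D'. divisor_tuple m d \<and> drop (length ns) d = ds"
    and "D \<inter> D' = {}"
    and "C' \<subseteq> carrier (cyclic_sum (replicate N 2))"
    and "odd (card C')"
    and "integral_graph G"
    and "digraph_iso (with_proj (cayley_graph (cyclic_sum m) (gcd_set m D')))
           (with_proj (kronecker_product (cubelike_graph N C') G))"
  shows "periodic_at (cayley_graph (cyclic_sum m) (gcd_set m (D \<union> D'))) pi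
    \<longleftrightarrow> eigenvalues_same_parity G"
proof -
  let ?\<Gamma> = "cyclic_sum m" and ?S = "gcd_set m D" and ?T = "gcd_set m D'"
  let ?K = "kronecker_product (cubelike_graph N C') G"
  have "\<forall>x\<in>set m. 0 < x"
    using assms(2,3) by (auto simp: set_zip prime_gt_0_nat)
  then have pos: "\<forall>i<length m. 0 < m ! i"
    by simp
  interpret self_dual_group ?\<Gamma> "cyclic_char m"
    by (rule self_dual_group_cyclic_sum[OF pos])
  have ic: "inv_closed (gcd_set m E)" for E
    using gcd_set_subset inv_gcd_set[OF pos] by (auto simp: inv_closed_def)
  have disj: "?S \<inter> ?T = {}"
    using assms(4,8,9) by (intro gcd_set_disjoint) (auto simp: divisor_tuple_def)
  \<comment> \<open>State transfer gives periodicity at twice the time; the multiplier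
    \<open>2 ^ (k - 1)\<close> then reaches \<open>pi\<close>, where \<open>0 < k\<close> makes the
    subtraction exact.\<close>
  have "periodic_at (cayley_graph ?\<Gamma> ?S) (of_nat (2 ^ (k - 1)) * (2 * (pi / 2 ^ k)))"
    by (intro periodic_at_cayley_graph_mult perfect_state_transfer_imp_periodic ic assms(6))
  moreover have "of_nat (2 ^ (k - 1)) * (2 * (pi / 2 ^ k)) = pi"
    using assms(5) by (cases k) auto
  ultimately have "periodic_at (cayley_graph ?\<Gamma> ?S) pi"
    by simp
  then have "periodic_at (cayley_graph ?\<Gamma> (gcd_set m (D \<union> D'))) pi \<longleftrightarrow>
      periodic_at (cayley_graph ?\<Gamma> ?T) pi"
    unfolding gcd_set_Un by (rule periodic_at_Un_iff[OF ic ic disj])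
  \<comment> \<open>The character sums are exactly the eigenvalues, so the phase condition becomes
    one on the spectrum, which the isomorphism preserves.\<close>
  also have "\<dots> \<longleftrightarrow>
      (\<exists>c. \<forall>x. graph_eigenvalue (cayley_graph ?\<Gamma> ?T) x \<longrightarrow> exp (\<i> * of_real pi * x) = c)"
    unfolding periodic_at_cayley_graph_iff[OF ic] graph_eigenvalue_cayley_graph_iff[OF ic] by blast
  also have "\<dots> \<longleftrightarrow> (\<exists>c. \<forall>x. graph_eigenvalue ?K x \<longrightarrow> exp (\<i> * of_real pi * x) = c)"
    unfolding graph_eigenvalue_digraph_iso[OF assms(13)] ..
  also have "\<dots> \<longleftrightarrow> eigenvalues_same_parity G"
    unfolding kronecker_cubelike_parity[OF assms(10,11,12)] eigenvalues_same_parity_iff[OF assms(12)] ..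
  finally show ?thesis .
qed

end
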